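(* As formal power series in $q$ (equivalently, for complex $q$ with $|q|<1$), $$\sum_{n\ge 0}\frac{q^{n^2+n}}{(q;q)_{2n+1}}=\frac{1}{(q;q)_\infty}\sum_{k\in\mathbb{Z}}\left(q^{15k^2-4k}-q^{15k^2+14k+3}\right).$$
   Context: $(q;q)_n=\prod_{j=1}^{n}(1-q^j)$ and $(q;q)_\infty=\prod_{j\ge1}(1-q^j)$. *)

theory Defs
  imports "HOL-Analysis.Analysis"
begin

text \<open>
  The symbols $(q;q)_n$ and $(q;q)_\infty$ over an arbitrary Hausdorff commutative ring, so that
  they can be used both for the indeterminate \<^term>\<open>fps_X\<close> in a ring of formal power series
  (with its usual \<open>X\<close>-adic metric) and for a complex number \<open>q\<close>.
\<close>

definition qfact :: "'a :: {t2_space, comm_ring_1} \<Rightarrow> nat \<Rightarrow> 'a" where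
  "qfact q n = (\<Prod>j = 1..n. 1 - q ^ j)"

text \<open>\<^const>\<open>prodinf\<close> is indexed from \<open>0\<close>, hence the shift of the exponent.\<close>

definition qfact_inf :: "'a :: {t2_space, comm_ring_1} \<Rightarrow> 'a" where
  "qfact_inf q = (\<Prod>j. 1 - q ^ Suc j)"

text \<open>
  \<^const>\<open>prodinf\<close> is unspecified for divergent products; this does not happen in the two settings
  of interest.
\<close>

lemma convergent_prod_qfact_complex:
  fixes q :: complex
  assumes "norm q < 1"
  shows "convergent_prod (\<lambda>j. 1 - q ^ Suc j)"
proof -
  have "summable (\<lambda>j. norm q * norm q ^ j)"
    using assms by (intro summable_mult summable_geometric) auto
  then have "summable (\<lambda>j. norm ((1 - q ^ Suc j) - 1))"
    by (simp add: norm_mult norm_power)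
  then show ?thesis
    by (intro abs_convergent_prod_imp_convergent_prod)
       (simp add: abs_convergent_prod_conv_summable)
qed

lemma convergent_prod_qfact_fps:
  "convergent_prod (\<lambda>j. 1 - (fps_X :: 'a :: field fps) ^ Suc j)"
proof -
  let ?f = "\<lambda>j. 1 - (fps_X :: 'a fps) ^ Suc j"
  let ?P = "\<lambda>n. prod ?f {..n}"
  define p where "p = Abs_fps (\<lambda>m. fps_nth (?P m) m)"
  have P_Suc: "fps_nth (?P (Suc n)) m = fps_nth (?P n) m" if "m \<le> n" for n m
  proof -
    have "?P (Suc n) = ?P n - ?P n * fps_X ^ Suc (Suc n)"
      by (simp only: prod.atMost_Suc right_diff_distrib mult_1_right)
    with that show ?thesis
      by (simp only: fps_sub_nth fps_X_power_mult_right_nth) simp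
  qed
  have stable: "fps_nth (?P n) m = fps_nth (?P m) m" if "m \<le> n" for n m
    using that
  proof (induction n rule: dec_induct)
    case (step n)
    then show ?case using P_Suc[of m n] by (simp only:)
  qed simp
  have p: "?P \<longlonglongrightarrow> p"
  proof (rule tendsto_fpsI)
    fix m
    show "\<forall>\<^sub>F n in sequentially. fps_nth (?P n) m = fps_nth p m"
      unfolding p_def fps_nth_Abs_fps
      by (rule eventually_mono[OF eventually_ge_at_top[of m]]) (rule stable)
  qed
  have "fps_nth p 0 = 1"
    by (simp add: p_def)
  then have "p \<noteq> 0" by auto
  with p have "raw_has_prod ?f 0 p"
    unfolding raw_has_prod_def by simp
  then show ?thesis
    unfolding convergent_prod_def by blast
qed

text \<open>
  The exponents $15k^2-4k$ and $15k^2+14k+3$ are nonnegative for every integer $k$, so \<open>fps_X powi e\<close>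
  denotes an honest power for these \<open>e\<close>, although \<^term>\<open>fps_X\<close> is not invertible.
\<close>

end

theory Submission
  imports Defs
begin

text \<open>
  This is the Bailey chain for \<open>a = q\<close>. Repeated use of the \<open>q\<close>-Pascal rule gives the finite identity
  \[ \sum_{k} \Big( \frac{q^{6k^2-k}}{(q)_{n+1-3k}\,(q)_{n+3k}}
      - \frac{q^{6k^2+5k+1}}{(q)_{n-1-3k}\,(q)_{n+2+3k}} \Big) = \frac{1}{(q)_{2n+1}}, \]
  with \<open>1 / (q)\<^sub>m = 0\<close> for \<open>m < 0\<close>. Multiplying by \<open>q^(n^2+n) / (q)\<^bsub>N-n\<^esub>\<close>, summing over \<open>n \<le> N\<close>, and evaluating
  the inner sums by
  \[ \sum_{n \le N} \frac{q^{n^2+n}}{(q)_{N-n}\,(q)_{n-r}\,(q)_{n+r+1}}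
      = \frac{q^{r^2+r}}{(q)_{N-r}\,(q)_{N+r+1}} \]
  with \<open>r = 3k - 1\<close> and \<open>r = 3k + 1\<close> produces the exponents \<open>15k^2 - 4k\<close> and \<open>15k^2 + 14k + 3\<close>.
  Tannery's theorem for \<open>N \<rightarrow> \<infinity>\<close> turns this into the claim divided by \<open>(q)\<^sub>\<infinity>\<close>.
\<close>

section \<open>Majorants, exponents and telescoping over the integers\<close>

text \<open>Provides the majorant for the two-sided theta series. The two half-lines overlap at 0,
  which does not affect summability on their union.\<close>

lemma summable_on_power_abs_int:
  fixes r c :: real
  assumes "0 \<le> r" "r < 1"
  shows "(\<lambda>k. c * r ^ nat \<bar>k\<bar>) summable_on (UNIV :: int set)"
proof -
  have r: "(\<lambda>n. r ^ n) summable_on UNIV"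
    using assms by (simp add: summable_on_UNIV_nonneg_real_iff summable_geometric)
  have 1: "(\<lambda>k. r ^ nat \<bar>k\<bar>) summable_on range int"
    using r by (subst summable_on_reindex) (auto simp: o_def)
  have 2: "(\<lambda>k. r ^ nat \<bar>k\<bar>) summable_on range (\<lambda>n. - int n)"
    using r by (subst summable_on_reindex) (auto simp: o_def inj_on_def)
  have "range int \<union> range (\<lambda>n. - int n) = UNIV"
  proof -
    have "k \<in> range int \<union> range (\<lambda>n. - int n)" for k
      by (cases k rule: int_cases2) auto
    then show ?thesis by blast
  qed
  with summable_on_union[OF 1 2] have "(\<lambda>k. r ^ nat \<bar>k\<bar>) summable_on UNIV"
    by simp
  then show ?thesis
    by (rule summable_on_cmult_right)
qed

text \<open>All six bounds follow from |k| <= k^2. The first four keep \<open>nat\<close> from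
  truncating exponents; the last two let the theta terms be dominated by powers with exponent
  |k|.\<close>

lemma exponents_nonneg:
  fixes k :: int
  shows "6*k\<^sup>2 - k \<ge> 0" "6*k\<^sup>2 + 5*k + 1 \<ge> 0" "9*k\<^sup>2 - 3*k \<ge> 0" "9*k\<^sup>2 + 9*k + 2 \<ge> 0"
    "15*k\<^sup>2 - 4*k \<ge> \<bar>k\<bar>" "15*k\<^sup>2 + 14*k + 3 \<ge> \<bar>k\<bar>"
proof -
  have "\<bar>k\<bar> \<le> k\<^sup>2"
    using self_le_power[of "\<bar>k\<bar>" 2] by (cases "k = 0") auto
  then show "6*k\<^sup>2 - k \<ge> 0" "6*k\<^sup>2 + 5*k + 1 \<ge> 0" "9*k\<^sup>2 - 3*k \<ge> 0" "9*k\<^sup>2 + 9*k + 2 \<ge> 0"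
    "15*k\<^sup>2 - 4*k \<ge> \<bar>k\<bar>" "15*k\<^sup>2 + 14*k + 3 \<ge> \<bar>k\<bar>"
    by linarith+
qed

lemma sum_int_telescope:
  fixes R :: "int \<Rightarrow> 'a :: ab_group_add"
  assumes "a \<le> b + 1"
  shows "(\<Sum>k\<in>{a..b}. R k - R (k + 1)) = R a - R (b + 1)"
proof -
  have "(\<Sum>k\<in>{a..a + int m - 1}. R k - R (k + 1)) = R a - R (a + int m)" for m
  proof (induction m)
    case (Suc m)
    have "{a..a + int (Suc m) - 1} = insert (a + int m) {a..a + int m - 1}" by auto
    with Suc show ?case by (simp add: algebra_simps)
  qed simp
  from this[of "nat (b + 1 - a)"] assms show ?thesis by simp
qed

section \<open>A common setting for power series and complex numbers\<close>

text \<open>The metric on formal power series and the absolute value on \<open>\<complex>\<close> satisfy these axioms alike,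
  so that both forms of the identity have one proof.\<close>

locale submultiplicative_dist =
  fixes q :: "'a :: {complete_space, idom_divide, inverse}"
  assumes dist_add_right: "\<And>x y z :: 'a. dist (x + z) (y + z) = dist x y"
    and dist_mult_le: "\<And>x y :: 'a. dist (x * y) 0 \<le> dist x 0 * dist y 0"
    and dist_one: "dist (1 :: 'a) 0 = 1"
    and dist_q: "dist q 0 < 1"
begin

abbreviation nrm :: "'a \<Rightarrow> real" where "nrm x \<equiv> dist x 0"

lemma dist_eq_nrm: "dist x y = nrm (x - y)"
  using dist_add_right[of x "- y" y] by simp

lemma nrm_add_le: "nrm (x + y) \<le> nrm x + nrm y"
  using dist_triangle[of "x + y" 0 y] dist_add_right[of x y 0] by simp

lemma nrm_minus: "nrm (- x) = nrm x"
  using dist_eq_nrm[of 0 x] by (simp add: dist_commute)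

lemma nrm_diff_le: "nrm (x - y) \<le> nrm x + nrm y"
  using nrm_add_le[of x "- y"] by (simp add: nrm_minus)

lemma nrm_sum_le: "nrm (sum f A) \<le> (\<Sum>x\<in>A. nrm (f x))"
proof (induction A rule: infinite_finite_induct)
  case (insert x A)
  then show ?case using nrm_add_le[of "f x" "sum f A"] by simp
qed auto

lemma nrm_power_le: "nrm (x ^ n) \<le> nrm x ^ n"
proof (induction n)
  case (Suc n)
  have "nrm (x ^ Suc n) \<le> nrm x * nrm (x ^ n)"
    using dist_mult_le by simp
  also have "\<dots> \<le> nrm x * nrm x ^ n"
    using Suc by (intro mult_left_mono) auto
  finally show ?case by simp
qed (simp add: dist_one)

lemma nrm_q_power_le: "nrm (q ^ n) \<le> nrm q ^ m" if "m \<le> n"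
proof -
  have "nrm q ^ n \<le> nrm q ^ m"
    using that dist_q by (intro power_decreasing) auto
  with nrm_power_le[of q n] show ?thesis by linarith
qed

section \<open>Limits of sums and products\<close>

lemma tendsto_iff_nrm: "((f :: 'b \<Rightarrow> 'a) \<longlongrightarrow> a) F \<longleftrightarrow> ((\<lambda>x. nrm (f x - a)) \<longlongrightarrow> 0) F"
  by (subst tendsto_dist_iff) (simp add: dist_eq_nrm[symmetric])

lemma tendsto_add_nrm:
  fixes f g :: "'b \<Rightarrow> 'a"
  assumes "(f \<longlongrightarrow> a) F" "(g \<longlongrightarrow> b) F"
  shows "((\<lambda>x. f x + g x) \<longlongrightarrow> a + b) F"
  unfolding tendsto_iff_nrm
proof (rule Lim_null_comparison)
  show "\<forall>\<^sub>F x in F. norm (nrm (f x + g x - (a + b))) \<le> nrm (f x - a) + nrm (g x - b)"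
    using nrm_add_le[of "f x - a" "g x - b" for x] by (intro always_eventually) (simp add: algebra_simps)
  show "((\<lambda>x. nrm (f x - a) + nrm (g x - b)) \<longlongrightarrow> 0) F"
    using tendsto_add[OF assms[unfolded tendsto_iff_nrm]] by simp
qed

lemma tendsto_mult_nrm:
  fixes f g :: "'b \<Rightarrow> 'a"
  assumes "(f \<longlongrightarrow> a) F" "(g \<longlongrightarrow> b) F"
  shows "((\<lambda>x. f x * g x) \<longlongrightarrow> a * b) F"
  unfolding tendsto_iff_nrm
proof (rule Lim_null_comparison)
  have "nrm (f x * g x - a * b) \<le> nrm (f x - a) * nrm (g x) + nrm a * nrm (g x - b)" for x
  proof -
    have "f x * g x - a * b = (f x - a) * g x + a * (g x - b)"
      by (simp add: algebra_simps)
    then show ?thesis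
      using nrm_add_le[of "(f x - a) * g x" "a * (g x - b)"]
        dist_mult_le[of "f x - a" "g x"] dist_mult_le[of a "g x - b"] by simp
  qed
  then show "\<forall>\<^sub>F x in F. norm (nrm (f x * g x - a * b))
      \<le> nrm (f x - a) * nrm (g x) + nrm a * nrm (g x - b)"
    by simp
  have "((\<lambda>x. nrm (f x - a) * nrm (g x) + nrm a * nrm (g x - b)) \<longlongrightarrow> 0 * nrm b + nrm a * 0) F"
    using assms by (intro tendsto_intros) (auto simp: tendsto_iff_nrm[symmetric])
  then show "((\<lambda>x. nrm (f x - a) * nrm (g x) + nrm a * nrm (g x - b)) \<longlongrightarrow> 0) F"
    by simp
qed

lemma tendsto_sum_nrm:
  fixes f :: "'b \<Rightarrow> 'i \<Rightarrow> 'a"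
  assumes "\<And>k. k \<in> A \<Longrightarrow> ((\<lambda>N. f N k) \<longlongrightarrow> g k) F"
  shows "((\<lambda>N. \<Sum>k\<in>A. f N k) \<longlongrightarrow> sum g A) F"
  using assms
  by (induction A rule: infinite_finite_induct) (auto intro!: tendsto_add_nrm)

lemma tendsto_diff_nrm:
  fixes f g :: "'b \<Rightarrow> 'a"
  assumes "(f \<longlongrightarrow> a) F" "(g \<longlongrightarrow> b) F"
  shows "((\<lambda>x. f x - g x) \<longlongrightarrow> a - b) F"
  using tendsto_add_nrm[OF assms(1) tendsto_mult_nrm[OF tendsto_const[of "-1"] assms(2)]] by simp

lemma has_sum_cmult_nrm:
  fixes f :: "'b \<Rightarrow> 'a"
  assumes "(f has_sum L) A"
  shows "((\<lambda>x. c * f x) has_sum (c * L)) A"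
  using tendsto_mult_nrm[OF tendsto_const assms[unfolded has_sum_def]]
  by (simp add: has_sum_def sum_distrib_left)

section \<open>Dominated series and interchange of limit and sum\<close>

text \<open>Weierstrass' M-test: the tails of \<open>f\<close> are bounded by those of
  \<open>M\<close>, so the partial sums are Cauchy and completeness applies.\<close>

lemma dominated_sums:
  fixes f :: "nat \<Rightarrow> 'a"
  assumes "\<And>n. nrm (f n) \<le> M n" and M: "summable M"
  obtains L where "f sums L"
proof -
  have "Cauchy (\<lambda>n. sum f {..<n})"
  proof (rule metric_CauchyI)
    fix e :: real assume "e > 0"
    then obtain N where N: "\<And>m n. m \<ge> N \<Longrightarrow> norm (sum M {m..<n}) < e"
      using M unfolding summable_Cauchy by blast
    have *: "dist (sum f {..<m}) (sum f {..<n}) < e" if "N \<le> n" "n \<le> m" for m n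
    proof -
      have "sum f {..<m} - sum f {..<n} = sum f {n..<m}"
        using sum_diff_nat_ivl[of 0 n m f] that by (simp add: atLeast0LessThan)
      then have "dist (sum f {..<m}) (sum f {..<n}) \<le> (\<Sum>k=n..<m. nrm (f k))"
        unfolding dist_eq_nrm[of "sum f {..<m}"] using nrm_sum_le by simp
      also have "\<dots> \<le> sum M {n..<m}"
        using assms by (intro sum_mono) auto
      also have "\<dots> < e" using N[OF that(1), of m] by simp
      finally show ?thesis .
    qed
    show "\<exists>N. \<forall>m\<ge>N. \<forall>n\<ge>N. dist (sum f {..<m}) (sum f {..<n}) < e"
    proof (intro exI[of _ N] allI impI)
      fix m n assume "m \<ge> N" "n \<ge> N"
      then show "dist (sum f {..<m}) (sum f {..<n}) < e"
        using *[of n m] *[of m n] by (cases "n \<le> m") (auto simp: dist_commute)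
    qed
  qed
  then have "convergent (\<lambda>n. sum f {..<n})"
    by (rule Cauchy_convergent)
  then show ?thesis
    using that unfolding convergent_def sums_def by blast
qed

text \<open>Tannery's theorem; only the forward direction provides the value of a sum that is not
  yet known to exist, the backward one computes a limit.\<close>

lemma tannery:
  fixes f :: "nat \<Rightarrow> 'i \<Rightarrow> 'a"
  assumes M: "M summable_on UNIV"
    and bound: "\<And>N k. nrm (f N k) \<le> M k"
    and lim: "\<And>k. (\<lambda>N. f N k) \<longlonglongrightarrow> g k"
    and fin: "\<And>N. finite (S N)"
    and supp: "\<And>N k. k \<notin> S N \<Longrightarrow> f N k = 0"
  shows "(\<lambda>N. sum (f N) (S N)) \<longlonglongrightarrow> L \<longleftrightarrow> (g has_sum L) UNIV"
proof -
  \<comment> \<open>Both directions use this: off a finite \<open>X\<close> the majorant has mass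
    below \<open>e / 2\<close>, so every finite \<open>A\<close> containing \<open>X\<close>
    captures the sum for large \<open>N\<close> up to \<open>e\<close>.\<close>
  have approx: "\<exists>X. finite X \<and> (\<forall>A. finite A \<and> X \<subseteq> A \<longrightarrow>
      (\<forall>\<^sub>F N in sequentially. dist (sum (f N) (S N)) (sum g A) < e))" if "e > 0" for e
  proof -
    from M obtain m where "(M has_sum m) UNIV"
      by (auto simp: summable_on_def)
    then have "\<forall>\<^sub>F X in finite_subsets_at_top UNIV. dist (sum M X) m < e / 4"
      unfolding has_sum_def using that by (intro tendstoD) auto
    then obtain X where X: "finite X" "\<And>Y. finite Y \<Longrightarrow> X \<subseteq> Y \<Longrightarrow> dist (sum M Y) m < e / 4"
      by (auto simp: eventually_finite_subsets_at_top)
    \<comment> \<open>Two sums within \<open>e / 4\<close> of \<open>m\<close> differ by less than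
      \<open>e / 2\<close>.\<close>
    have tail: "sum M B < e / 2" if "finite B" "B \<inter> X = {}" for B
    proof -
      have "sum M (X \<union> B) = sum M X + sum M B"
        using that X by (intro sum.union_disjoint) auto
      moreover have "dist (sum M (X \<union> B)) m < e / 4" "dist (sum M X) m < e / 4"
        using that X by auto
      ultimately show ?thesis by (auto simp: dist_real_def abs_if split: if_splits)
    qed
    have "\<forall>\<^sub>F N in sequentially. dist (sum (f N) (S N)) (sum g A) < e"
      if A: "finite A" "X \<subseteq> A" for A
    proof -
      have "(\<lambda>N. sum (f N) A) \<longlonglongrightarrow> sum g A"
        using lim by (intro tendsto_sum_nrm)
      then have "\<forall>\<^sub>F N in sequentially. dist (sum (f N) A) (sum g A) < e / 2"
        using \<open>e > 0\<close> by (intro tendstoD) auto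
      then show ?thesis
      proof eventually_elim
        case (elim N)
        \<comment> \<open>Adding \<open>A\<close> to \<open>S N\<close> only adds zero terms; what
          then remains outside \<open>A\<close> avoids \<open>X\<close>.\<close>
        have "sum (f N) (S N) = sum (f N) (S N \<union> A)"
          using fin A supp by (intro sum.mono_neutral_left) auto
        also have "\<dots> = sum (f N) A + sum (f N) (S N - A)"
          using fin A by (subst sum.union_disjoint[symmetric]) (auto simp: Un_commute)
        finally have "dist (sum (f N) (S N)) (sum (f N) A) = nrm (sum (f N) (S N - A))"
          by (simp add: dist_eq_nrm[of _ "sum (f N) A"])
        also have "\<dots> \<le> (\<Sum>k\<in>S N - A. nrm (f N k))" by (rule nrm_sum_le)
        also have "\<dots> \<le> sum M (S N - A)" using bound by (intro sum_mono)
        also have "\<dots> < e / 2" using fin A by (intro tail) auto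
        finally show ?case
          using elim dist_triangle[of "sum (f N) (S N)" "sum g A" "sum (f N) A"] by linarith
      qed
    qed
    with X show ?thesis by blast
  qed
  show ?thesis
  proof
    assume F: "(\<lambda>N. sum (f N) (S N)) \<longlonglongrightarrow> L"
    show "(g has_sum L) UNIV"
      unfolding has_sum_def
    proof (rule tendstoI)
      fix e :: real assume e: "e > 0"
      then obtain X where X: "finite X" "\<And>A. finite A \<Longrightarrow> X \<subseteq> A \<Longrightarrow>
          (\<forall>\<^sub>F N in sequentially. dist (sum (f N) (S N)) (sum g A) < e / 2)"
        using approx[of "e / 2"] by auto
      have "dist (sum g A) L < e" if "finite A" "X \<subseteq> A" for A
      proof -
        have "\<forall>\<^sub>F N in sequentially. dist (sum (f N) (S N)) L < e / 2"
          using F e by (intro tendstoD) auto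
        with X(2)[OF that] have "\<forall>\<^sub>F N in sequentially. dist (sum g A) L < e"
        proof eventually_elim
          case (elim N)
          then show ?case
            using dist_triangle2[of "sum g A" L "sum (f N) (S N)"]
            by (simp add: dist_commute)
        qed
        \<comment> \<open>The inequality does not mention \<open>N\<close>, so holding eventually it
          holds outright.\<close>
        then show ?thesis by simp
      qed
      with X(1) show "\<forall>\<^sub>F A in finite_subsets_at_top UNIV. dist (sum g A) L < e"
        by (auto simp: eventually_finite_subsets_at_top)
    qed
  next
    assume g: "(g has_sum L) UNIV"
    show "(\<lambda>N. sum (f N) (S N)) \<longlonglongrightarrow> L"
    proof (rule tendstoI)
      fix e :: real assume e: "e > 0"
      then obtain X where X: "finite X" "\<And>A. finite A \<Longrightarrow> X \<subseteq> A \<Longrightarrow>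
          (\<forall>\<^sub>F N in sequentially. dist (sum (f N) (S N)) (sum g A) < e / 2)"
        using approx[of "e / 2"] by auto
      have "\<forall>\<^sub>F A in finite_subsets_at_top UNIV. dist (sum g A) L < e / 2"
        using g e unfolding has_sum_def by (intro tendstoD) auto
      then obtain Y where Y: "finite Y"
          "\<And>A. finite A \<Longrightarrow> Y \<subseteq> A \<Longrightarrow> dist (sum g A) L < e / 2"
        by (auto simp: eventually_finite_subsets_at_top)
      have XY: "dist (sum g (X \<union> Y)) L < e / 2"
        using X Y by auto
      have "\<forall>\<^sub>F N in sequentially. dist (sum (f N) (S N)) (sum g (X \<union> Y)) < e / 2"
        using X Y by auto
      then show "\<forall>\<^sub>F N in sequentially. dist (sum (f N) (S N)) L < e"
      proof eventually_elim
        case (elim N)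
        with XY show ?case
          using dist_triangle[of "sum (f N) (S N)" L "sum g (X \<union> Y)"] by simp
      qed
    qed
  qed
qed

text \<open>\<open>tannery\<close>, applied to the truncations of \<open>f\<close>, identifies the
  limit of the ordered partial sums as the unordered sum.\<close>

lemma dominated_has_sum_nat:
  fixes f :: "nat \<Rightarrow> 'a"
  assumes bound: "\<And>n. nrm (f n) \<le> M n" and M: "summable M"
  obtains L where "(f has_sum L) UNIV"
proof -
  obtain L where L: "f sums L"
    using dominated_sums assms by blast
  have M0: "M n \<ge> 0" for n
    using bound[of n] zero_le_dist[of "f n" 0] by linarith
  have "M summable_on UNIV"
    using M M0 by (simp add: summable_on_UNIV_nonneg_real_iff)
  then have "(\<lambda>N. \<Sum>n<N. if n < N then f n else 0) \<longlonglongrightarrow> L \<longleftrightarrow> (f has_sum L) UNIV"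
  proof (rule tannery)
    fix n
    have "\<forall>\<^sub>F N in sequentially. (if n < N then f n else 0) = f n"
      using eventually_gt_at_top[of n] by eventually_elim simp
    then show "(\<lambda>N. if n < N then f n else 0) \<longlonglongrightarrow> f n"
      by (rule tendsto_eventually)
  qed (use bound M0 in auto)
  moreover have "(\<lambda>N. \<Sum>n<N. if n < N then f n else 0) = (\<lambda>N. \<Sum>n<N. f n)"
    by auto
  ultimately show ?thesis
    using L that by (simp add: sums_def)
qed

section \<open>Inverses of 1 - q^n and the limits of the q-factorials\<close>

lemma summable_nrm_q_power: "summable (\<lambda>n. c * nrm q ^ n)"
  using dist_q by (intro summable_mult summable_geometric) auto

text \<open>Neumann series: the partial sums times 1 - x telescope to 1 - x^n, which tends to
  1.\<close>

lemma geometric_inverse: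
  assumes "nrm x < 1"
  obtains v where "v * (1 - x) = 1" "nrm v \<le> 1 / (1 - nrm x)"
proof -
  have "summable (\<lambda>n. nrm x ^ n)"
    using assms by (intro summable_geometric) auto
  then obtain v where v: "(\<lambda>n. x ^ n) sums v"
    using dominated_sums nrm_power_le by blast
  have "(\<lambda>n. nrm x ^ n) \<longlonglongrightarrow> 0"
    using assms by (intro LIMSEQ_realpow_zero) auto
  then have "(\<lambda>n. nrm (x ^ n)) \<longlonglongrightarrow> 0"
    by (rule Lim_null_comparison[rotated]) (simp add: nrm_power_le)
  then have x0: "(\<lambda>n. x ^ n) \<longlonglongrightarrow> 0"
    using tendsto_iff_nrm[of "\<lambda>n. x ^ n" 0] by simp
  have eq: "(\<lambda>n. sum ((^) x) {..<n} * (1 - x)) = (\<lambda>n. 1 - x ^ n)"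
    using one_diff_power_eq[of x] by (simp add: fun_eq_iff mult.commute)
  have "(\<lambda>n. sum ((^) x) {..<n} * (1 - x)) \<longlonglongrightarrow> v * (1 - x)"
    using v unfolding sums_def by (intro tendsto_mult_nrm tendsto_const)
  moreover have "(\<lambda>n. 1 - x ^ n) \<longlonglongrightarrow> 1 - 0"
    by (intro tendsto_diff_nrm tendsto_const x0)
  ultimately have "v * (1 - x) = 1"
    unfolding eq by (auto dest: LIMSEQ_unique)
  moreover from this have v_eq: "v = 1 + v * x"
    by (simp add: algebra_simps)
  \<comment> \<open>The bound is read off from \<open>v = 1 + v * x\<close> by solving for
    \<open>nrm v\<close>.\<close>
  have "nrm v \<le> 1 + nrm v * nrm x"
    using nrm_add_le[of 1 "v * x"] dist_mult_le[of v x] dist_one v_eq by simp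
  then have "nrm v \<le> 1 / (1 - nrm x)"
    using assms by (simp add: field_simps)
  ultimately show ?thesis using that by blast
qed

text \<open>Relative increments of geometric size let \<open>x\<close> grow at most like the product
  of the factors 1 + D |q|^i, which an exponential bounds. The increments themselves are then
  dominated by a geometric series. The multiplicative hypothesis suits both (q)_n and
  1/(q)_n.\<close>

lemma convergent_of_small_quotients:
  fixes x :: "nat \<Rightarrow> 'a"
  assumes step: "\<And>n. nrm (x (Suc n) - x n) \<le> D * nrm q ^ n * nrm (x n)" and D: "D \<ge> 0"
  obtains L C where "x \<longlonglongrightarrow> L" "\<And>n. nrm (x n) \<le> C"
proof -
  define C where "C = nrm (x 0) * exp (\<Sum>n. D * nrm q ^ n)"
  have growth: "nrm (x n) \<le> nrm (x 0) * exp (\<Sum>i<n. D * nrm q ^ i)" for n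
  proof (induction n)
    case (Suc n)
    have "nrm (x (Suc n)) \<le> nrm (x n) + nrm (x (Suc n) - x n)"
      using nrm_add_le[of "x n" "x (Suc n) - x n"] by simp
    also have "\<dots> \<le> nrm (x n) * (1 + D * nrm q ^ n)"
      using step[of n] by (simp add: algebra_simps)
    also have "\<dots> \<le> nrm (x 0) * exp (\<Sum>i<n. D * nrm q ^ i) * exp (D * nrm q ^ n)"
      using Suc D by (intro mult_mono) (auto simp: exp_ge_add_one_self)
    finally show ?case by (simp add: exp_add mult.assoc)
  qed simp
  have C: "nrm (x n) \<le> C" for n
  proof -
    have "(\<Sum>i<n. D * nrm q ^ i) \<le> (\<Sum>i. D * nrm q ^ i)"
      using D by (intro sum_le_suminf summable_nrm_q_power) auto
    then have "nrm (x 0) * exp (\<Sum>i<n. D * nrm q ^ i) \<le> C"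
      unfolding C_def by (intro mult_left_mono) auto
    with growth[of n] show ?thesis by linarith
  qed
  have "nrm (x (Suc n) - x n) \<le> D * C * nrm q ^ n" for n
  proof -
    have "D * nrm q ^ n * nrm (x n) \<le> D * nrm q ^ n * C"
      using C D by (intro mult_left_mono) auto
    with step[of n] show ?thesis by (simp add: mult_ac)
  qed
  then obtain L where L: "(\<lambda>n. x (Suc n) - x n) sums L"
    by (rule dominated_sums[OF _ summable_nrm_q_power])
  have "(\<lambda>n. (\<Sum>i<n. x (Suc i) - x i) + x 0) \<longlonglongrightarrow> L + x 0"
    using L unfolding sums_def by (intro tendsto_add_nrm tendsto_const)
  then have "x \<longlonglongrightarrow> L + x 0"
    by (simp add: sum_lessThan_telescope)
  then show ?thesis using C by (rule that)
qed

lemma nrm_q_power_less_1: "n > 0 \<Longrightarrow> nrm (q ^ n) < 1"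
  using nrm_q_power_le[of 1 n] dist_q by simp

text \<open>The bound is uniform in \<open>n\<close> because |q^n| <= |q|; the convergence of
  \<open>iqfact\<close> relies on this uniformity.\<close>

lemma one_minus_q_power_unit:
  assumes "n > 0"
  obtains v where "v * (1 - q ^ n) = 1" "nrm v \<le> 1 / (1 - nrm q)"
proof -
  obtain v where v: "v * (1 - q ^ n) = 1" "nrm v \<le> 1 / (1 - nrm (q ^ n))"
    using geometric_inverse nrm_q_power_less_1[OF assms] by blast
  have "1 / (1 - nrm (q ^ n)) \<le> 1 / (1 - nrm q)"
    using nrm_q_power_le[of 1 n] assms dist_q by (intro divide_left_mono mult_pos_pos) auto
  with v that show ?thesis by fastforce
qed

lemma one_minus_q_power_neq_0: "n > 0 \<Longrightarrow> 1 - q ^ n \<noteq> 0"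
  using one_minus_q_power_unit[of n] by fastforce

lemma qfact_0: "qfact q 0 = 1"
  by (simp add: qfact_def)

lemma qfact_Suc: "qfact q (Suc n) = qfact q n * (1 - q ^ Suc n)"
  by (simp add: qfact_def)

definition iqfact :: "nat \<Rightarrow> 'a" where
  "iqfact n = 1 div qfact q n"

lemma qfact_neq_0: "qfact q n \<noteq> 0"
  unfolding qfact_def using one_minus_q_power_neq_0 by (simp del: right_minus_eq)

lemma div_unit_eq: "x div y = x * u" if "u * y = (1 :: 'a)"
proof -
  from that have "y \<noteq> 0" by auto
  moreover have "x = x * u * y" using that by (simp add: mult.assoc)
  ultimately show ?thesis
    by (metis nonzero_mult_div_cancel_right)
qed

text \<open>An inverse is built up factor by factor, which shows that the \<open>div\<close> in
  \<open>iqfact\<close> is exact.\<close>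

lemma iqfact_mult_qfact: "iqfact n * qfact q n = 1"
proof -
  have "\<exists>u. u * qfact q n = 1"
  proof (induction n)
    case (Suc n)
    then obtain u where "u * qfact q n = 1" by blast
    moreover obtain v where "v * (1 - q ^ Suc n) = 1"
      using one_minus_q_power_unit[of "Suc n"] by blast
    ultimately have "(u * qfact q n) * (v * (1 - q ^ Suc n)) = 1" by simp
    then have "(u * v) * qfact q (Suc n) = 1"
      unfolding qfact_Suc by (simp only: mult_ac)
    then show ?case by blast
  qed (simp add: qfact_0)
  then show ?thesis
    unfolding iqfact_def using div_unit_eq[of _ "qfact q n" 1] by auto
qed

lemma div_qfact: "x div qfact q n = x * iqfact n"
  by (rule div_unit_eq) (rule iqfact_mult_qfact)

lemma iqfact_0: "iqfact 0 = 1"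
  using iqfact_mult_qfact[of 0] by (simp add: qfact_0)

lemma iqfact_Suc: "iqfact (Suc n) * (1 - q ^ Suc n) = iqfact n"
proof -
  have "(iqfact (Suc n) * (1 - q ^ Suc n)) * qfact q n = iqfact n * qfact q n"
    using iqfact_mult_qfact[of "Suc n"] iqfact_mult_qfact[of n]
    unfolding qfact_Suc by (simp only: mult_ac)
  then show ?thesis
    using qfact_neq_0 mult_right_cancel by blast
qed

definition iqinf :: 'a where
  "iqinf = 1 div qfact_inf q"

text \<open>Both (q)_n and 1/(q)_n converge by \<open>convergent_of_small_quotients\<close>. The
  product of their limits is 1, so the infinite product is nonzero and its reciprocal is the limit
  of \<open>iqfact\<close>.\<close>

lemma iqfact_limit:
  obtains C where "iqfact \<longlonglongrightarrow> iqinf" "iqinf * qfact_inf q = 1" "\<And>n. nrm (iqfact n) \<le> C"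
proof -
  have "nrm (iqfact (Suc n) - iqfact n) \<le> 1 / (1 - nrm q) * nrm q ^ n * nrm (iqfact n)" for n
  proof -
    obtain v where v: "v * (1 - q ^ Suc n) = 1" "nrm v \<le> 1 / (1 - nrm q)"
      using one_minus_q_power_unit by blast
    have "iqfact (Suc n) = v * (1 - q ^ Suc n) * iqfact (Suc n)"
      using v by simp
    also have "\<dots> = v * iqfact n"
      using iqfact_Suc[of n] by (simp only: mult_ac)
    finally have 1: "iqfact (Suc n) = v * iqfact n" .
    have "iqfact (Suc n) - iqfact n = v * q ^ Suc n * iqfact n"
      using iqfact_Suc[of n, symmetric] 1 by (simp add: algebra_simps)
    then have "nrm (iqfact (Suc n) - iqfact n) \<le> nrm (v * q ^ Suc n) * nrm (iqfact n)"
      using dist_mult_le by presburger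
    also have "\<dots> \<le> nrm v * nrm (q ^ Suc n) * nrm (iqfact n)"
      by (intro mult_right_mono dist_mult_le) auto
    also have "\<dots> \<le> 1 / (1 - nrm q) * nrm q ^ n * nrm (iqfact n)"
      using v dist_q by (intro mult_right_mono mult_mono nrm_q_power_le) auto
    finally show ?thesis .
  qed
  then obtain I C where I: "iqfact \<longlonglongrightarrow> I" "\<And>n. nrm (iqfact n) \<le> C"
    using dist_q by (rule_tac convergent_of_small_quotients[of iqfact "1 / (1 - nrm q)"]) auto
  have "nrm (qfact q (Suc n) - qfact q n) \<le> 1 * nrm q ^ n * nrm (qfact q n)" for n
  proof -
    have "qfact q (Suc n) - qfact q n = - (q ^ Suc n * qfact q n)"
      by (simp add: qfact_Suc algebra_simps)
    then have "nrm (qfact q (Suc n) - qfact q n) \<le> nrm (q ^ Suc n) * nrm (qfact q n)"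
      using dist_mult_le nrm_minus by presburger
    also have "\<dots> \<le> nrm q ^ n * nrm (qfact q n)"
      by (intro mult_right_mono nrm_q_power_le) auto
    finally show ?thesis by simp
  qed
  then obtain P where P: "qfact q \<longlonglongrightarrow> P"
    by (rule convergent_of_small_quotients[of "qfact q" 1]) auto
  have "(\<lambda>n. iqfact n * qfact q n) \<longlonglongrightarrow> I * P"
    by (intro tendsto_mult_nrm I P)
  then have IP: "I * P = 1"
    by (simp add: iqfact_mult_qfact LIMSEQ_const_iff)
  \<comment> \<open>The factors are indexed from 0, so the partial product up to \<open>n\<close> is
    (q)_(n+1). The nonzero limit that \<open>raw_has_prod\<close> demands comes from
    \<open>IP\<close>.\<close>
  have "(\<lambda>n. \<Prod>i\<le>n. 1 - q ^ Suc i) = (\<lambda>n. qfact q (Suc n))"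
    unfolding qfact_def by (simp only: One_nat_def prod.atLeast_Suc_atMost_Suc_shift atLeast0AtMost o_def)
  then have "raw_has_prod (\<lambda>i. 1 - q ^ Suc i) 0 P"
    using LIMSEQ_Suc[OF P] IP unfolding raw_has_prod_def by auto
  then have "qfact_inf q = P"
    unfolding qfact_inf_def by (intro has_prod_unique[symmetric]) (simp add: has_prod_def)
  moreover from this IP have "iqinf = I"
    unfolding iqinf_def by (simp add: div_unit_eq)
  ultimately show ?thesis using that I IP by blast
qed

section \<open>Reciprocals with integer index and the q-Pascal rule\<close>

text \<open>The value 0 at negative indices gives the sums over \<open>k\<close> finite support and
  lets the recursions hold across the boundary.\<close>

definition iqz :: "int \<Rightarrow> 'a" where
  "iqz m = (if m < 0 then 0 else iqfact (nat m))"

lemma iqz_neg: "m < 0 \<Longrightarrow> iqz m = 0"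
  by (simp add: iqz_def)

lemma iqz_of_nat [simp]: "iqz (int n) = iqfact n"
  by (simp add: iqz_def)

text \<open>For m <= 0 both sides are 0, because \<open>nat m = 0\<close> makes the factor
  vanish.\<close>

lemma iqz_step: "(1 - q ^ nat m) * iqz m = iqz (m - 1)"
proof (cases "m \<ge> 1")
  case True
  define n where "n = nat (m - 1)"
  from True have n: "nat m = Suc n" "nat (m - 1) = n" by (auto simp: n_def)
  from True show ?thesis
    using iqfact_Suc[of n] n by (simp add: iqz_def mult.commute)
qed (auto simp: iqz_def)

text \<open>Splits 1 - q^(a+b) as (1 - q^a) + q^a (1 - q^b) and lowers one index in each part; a
  negative index makes everything 0.\<close>

lemma iqz_pascal:
  assumes "a + b = int L" "L > 0"
  shows "(1 - q ^ L) * (iqz a * iqz b) = iqz (a - 1) * iqz b + q ^ nat a * (iqz a * iqz (b - 1))"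
proof (cases "a \<ge> 0 \<and> b \<ge> 0")
  case True
  with assms have "q ^ L = q ^ nat a * q ^ nat b"
    by (metis nat_add_distrib nat_int power_add)
  then have "(1 - q ^ L) * (iqz a * iqz b)
      = ((1 - q ^ nat a) * iqz a) * iqz b + q ^ nat a * (iqz a * ((1 - q ^ nat b) * iqz b))"
    by (simp add: algebra_simps)
  then show ?thesis by (simp only: iqz_step)
qed (auto simp: iqz_def)

lemma iqz_tendsto: "(\<lambda>N. iqz (int N + c)) \<longlonglongrightarrow> iqinf"
proof -
  obtain C where "iqfact \<longlonglongrightarrow> iqinf" using iqfact_limit by blast
  moreover have "filterlim (\<lambda>N. nat (int N + c)) at_top at_top"
    unfolding filterlim_at_top
  proof
    fix Z :: nat
    show "\<forall>\<^sub>F N in sequentially. Z \<le> nat (int N + c)"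
      using eventually_ge_at_top[of "Z + nat \<bar>c\<bar>"] by eventually_elim linarith
  qed
  ultimately have "(\<lambda>N. iqfact (nat (int N + c))) \<longlonglongrightarrow> iqinf"
    by (rule filterlim_compose)
  moreover have "\<forall>\<^sub>F N in sequentially. iqfact (nat (int N + c)) = iqz (int N + c)"
    using eventually_ge_at_top[of "nat \<bar>c\<bar>"] by eventually_elim (auto simp: iqz_def)
  ultimately show ?thesis
    by (rule Lim_transform_eventually)
qed

section \<open>The finite identity for 1/(q)_(2n+1)\<close>

text \<open>The \<open>q\<close>-Pascal remainders cancel in pairs: those of the two families below differ by
  the shift \<open>k \<rightarrow> k - 1\<close> in the odd case and coincide in the even case.\<close>

definition odd_term :: "int \<Rightarrow> int \<Rightarrow> 'a" where
  "odd_term n k = q ^ nat (6*k\<^sup>2 - k) * (iqz (n + 1 - 3*k) * iqz (n + 3*k))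
     - q ^ nat (6*k\<^sup>2 + 5*k + 1) * (iqz (n - 1 - 3*k) * iqz (n + 2 + 3*k))"

definition even_term :: "int \<Rightarrow> int \<Rightarrow> 'a" where
  "even_term n k = q ^ nat (6*k\<^sup>2 - k) * (iqz (n - 3*k) * iqz (n + 3*k))
     - q ^ nat (6*k\<^sup>2 + 5*k + 1) * (iqz (n - 1 - 3*k) * iqz (n + 1 + 3*k))"

text \<open>The alternative \<open>z = 0\<close> covers exponents that \<open>nat\<close> would
  truncate: they occur only next to a vanishing \<open>iqz\<close> factor.\<close>

lemma q_power_nat_mult:
  assumes "a \<ge> 0" "b \<ge> 0 \<or> z = 0" "a + b = c"
  shows "q ^ nat a * (q ^ nat b * z) = q ^ nat c * z"
  using assms by (auto simp: nat_add_distrib power_add mult.assoc)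

lemma odd_term_step:
  fixes n :: nat and k :: int
  defines "R \<equiv> \<lambda>k. q ^ nat (6*k\<^sup>2 - 4*k + int n + 1) * (iqz (int n + 1 - 3*k) * iqz (int n + 3*k - 1))"
  shows "(1 - q ^ (2*n + 1)) * odd_term (int n) k = even_term (int n) k + (R k - R (k + 1))"
proof -
  have 1: "(1 - q ^ (2*n + 1)) * (iqz (int n + 1 - 3*k) * iqz (int n + 3*k))
      = iqz (int n - 3*k) * iqz (int n + 3*k)
        + q ^ nat (int n + 1 - 3*k) * (iqz (int n + 1 - 3*k) * iqz (int n + 3*k - 1))"
    by (subst iqz_pascal) (auto simp: algebra_simps)
  \<comment> \<open>The factors are swapped so that the main part lowers the index
    \<open>n + 2 + 3*k\<close>; this makes the remainder equal to \<open>R (k + 1)\<close>.\<close>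
  have 2: "(1 - q ^ (2*n + 1)) * (iqz (int n + 2 + 3*k) * iqz (int n - 1 - 3*k))
      = iqz (int n + 1 + 3*k) * iqz (int n - 1 - 3*k)
        + q ^ nat (int n + 2 + 3*k) * (iqz (int n + 2 + 3*k) * iqz (int n - 1 - 3*k - 1))"
    by (subst iqz_pascal) (auto simp: algebra_simps)
  have 3: "q ^ nat (6*k\<^sup>2 - k) * (q ^ nat (int n + 1 - 3*k) *
        (iqz (int n + 1 - 3*k) * iqz (int n + 3*k - 1))) = R k"
    unfolding R_def using exponents_nonneg[of k]
    by (intro q_power_nat_mult) (auto simp: iqz_def)
  have 4: "q ^ nat (6*k\<^sup>2 + 5*k + 1) * (q ^ nat (int n + 2 + 3*k) *
        (iqz (int n + 2 + 3*k) * iqz (int n - 1 - 3*k - 1))) = R (k + 1)"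
  proof -
    have "q ^ nat (6*k\<^sup>2 + 5*k + 1) * (q ^ nat (int n + 2 + 3*k) *
        (iqz (int n + 2 + 3*k) * iqz (int n - 1 - 3*k - 1)))
      = q ^ nat (6*(k+1)\<^sup>2 - 4*(k+1) + int n + 1) * (iqz (int n + 2 + 3*k) * iqz (int n - 1 - 3*k - 1))"
      using exponents_nonneg[of k]
      by (intro q_power_nat_mult) (auto simp: iqz_def power2_eq_square algebra_simps)
    then show ?thesis
      unfolding R_def by (simp add: algebra_simps)
  qed
  have "(1 - q ^ (2*n + 1)) * odd_term (int n) k
    = q ^ nat (6*k\<^sup>2 - k) * ((1 - q ^ (2*n + 1)) * (iqz (int n + 1 - 3*k) * iqz (int n + 3*k)))
     - q ^ nat (6*k\<^sup>2 + 5*k + 1) * ((1 - q ^ (2*n + 1)) * (iqz (int n + 2 + 3*k) * iqz (int n - 1 - 3*k)))"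
    unfolding odd_term_def by (simp only: right_diff_distrib mult_ac)
  also have "\<dots> = even_term (int n) k + (R k - R (k + 1))"
    unfolding 1 2 distrib_left 3 4 even_term_def by (simp add: mult_ac)
  finally show ?thesis .
qed

lemma even_term_step:
  assumes "n > 0"
  shows "(1 - q ^ (2*n)) * even_term (int n) k = odd_term (int n - 1) k"
proof -
  have 1: "(1 - q ^ (2*n)) * (iqz (int n + 3*k) * iqz (int n - 3*k))
      = iqz (int n - 1 + 3*k) * iqz (int n - 3*k)
        + q ^ nat (int n + 3*k) * (iqz (int n + 3*k) * iqz (int n - 1 - 3*k))"
    using assms by (subst iqz_pascal) (auto simp: algebra_simps)
  have 2: "(1 - q ^ (2*n)) * (iqz (int n - 1 - 3*k) * iqz (int n + 1 + 3*k))
      = iqz (int n - 2 - 3*k) * iqz (int n + 1 + 3*k)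
        + q ^ nat (int n - 1 - 3*k) * (iqz (int n - 1 - 3*k) * iqz (int n + 3*k))"
    using assms by (subst iqz_pascal) (auto simp: algebra_simps)
  \<comment> \<open>The common value of the two remainders, which cancel in the difference.\<close>
  let ?R = "q ^ nat (6*k\<^sup>2 + 2*k + int n) * (iqz (int n + 3*k) * iqz (int n - 1 - 3*k))"
  have 3: "q ^ nat (6*k\<^sup>2 - k) * (q ^ nat (int n + 3*k) *
        (iqz (int n + 3*k) * iqz (int n - 1 - 3*k))) = ?R"
    using exponents_nonneg[of k]
    by (intro q_power_nat_mult) (auto simp: iqz_def)
  have 4: "q ^ nat (6*k\<^sup>2 + 5*k + 1) * (q ^ nat (int n - 1 - 3*k) *
        (iqz (int n - 1 - 3*k) * iqz (int n + 3*k))) = ?R"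
    unfolding mult.commute[of "iqz (int n - 1 - 3*k)"] using exponents_nonneg[of k]
    by (intro q_power_nat_mult) (auto simp: iqz_def)
  have "(1 - q ^ (2*n)) * even_term (int n) k
    = q ^ nat (6*k\<^sup>2 - k) * ((1 - q ^ (2*n)) * (iqz (int n + 3*k) * iqz (int n - 3*k)))
     - q ^ nat (6*k\<^sup>2 + 5*k + 1) * ((1 - q ^ (2*n)) * (iqz (int n - 1 - 3*k) * iqz (int n + 1 + 3*k)))"
    unfolding even_term_def by (simp only: right_diff_distrib mult_ac)
  also have "\<dots> = odd_term (int n - 1) k"
    unfolding 1 2 distrib_left 3 4 odd_term_def by (simp add: algebra_simps)
  finally show ?thesis .
qed

text \<open>Alternating induction: the even case for \<open>n\<close> gives the odd case for
  \<open>n\<close>, and that gives the even case for \<open>n + 1\<close>; the nonzero factors 1 -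
  q^(2n+1) and 1 - q^(2n+2) are cancelled. One window \<open>K\<close> serves all smaller
  \<open>n\<close>.\<close>

lemma sum_odd_even_term:
  assumes K: "K > int n"
  shows "(\<Sum>k\<in>{-K..K}. even_term (int n) k) = iqfact (2*n)" (is "?even n")
    and "(\<Sum>k\<in>{-K..K}. odd_term (int n) k) = iqfact (2*n + 1)" (is "?odd n")
proof -
  have step: "?odd n" if "?even n" "K > int n" for n
  proof -
    define R where "R k = q ^ nat (6*k\<^sup>2 - 4*k + int n + 1)
      * (iqz (int n + 1 - 3*k) * iqz (int n + 3*k - 1))" for k
    have "(1 - q ^ (2*n + 1)) * (\<Sum>k\<in>{-K..K}. odd_term (int n) k)
        = iqfact (2*n) + (\<Sum>k\<in>{-K..K}. R k - R (k + 1))"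
      unfolding sum_distrib_left odd_term_step sum.distrib that(1) R_def by (rule refl)
    also have "(\<Sum>k\<in>{-K..K}. R k - R (k + 1)) = R (-K) - R (K + 1)"
      using that by (intro sum_int_telescope) auto
    \<comment> \<open>At both ends one index is negative, as 3K > n.\<close>
    also have "\<dots> = 0"
      using that by (simp add: R_def iqz_neg)
    finally have "(\<Sum>k\<in>{-K..K}. odd_term (int n) k) * (1 - q ^ (2*n + 1))
        = iqfact (2*n + 1) * (1 - q ^ (2*n + 1))"
      using iqfact_Suc[of "2*n"] by (simp add: mult.commute)
    then show ?thesis
      using mult_right_cancel[OF one_minus_q_power_neq_0[of "2*n + 1"]] by simp
  qed
  have "?even n" using K
  proof (induction n)
    case 0
    \<comment> \<open>Away from \<open>k = 0\<close> each of the two products contains a negative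
      index.\<close>
    have "even_term 0 k = 0" if "k \<noteq> 0" for k
    proof -
      have "iqz (- (3*k)) * iqz (3*k) = 0" "iqz (- 1 - 3*k) * iqz (1 + 3*k) = 0"
        using that by (auto simp: iqz_def)
      then show ?thesis unfolding even_term_def by (simp only: diff_0 add_0 diff_0_right mult_zero_right)
    qed
    then have "(\<Sum>k\<in>{-K..K}. even_term 0 k) = (\<Sum>k\<in>{0}. even_term 0 k)"
      using 0 by (intro sum.mono_neutral_right) auto
    then show ?case
      by (simp add: even_term_def iqz_def iqfact_0)
  next
    case (Suc n)
    have "(1 - q ^ (2 * Suc n)) * even_term (int (Suc n)) k = odd_term (int n) k" for k
      using even_term_step[of "Suc n" k] by simp
    then have "(1 - q ^ (2 * Suc n)) * (\<Sum>k\<in>{-K..K}. even_term (int (Suc n)) k)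
        = (\<Sum>k\<in>{-K..K}. odd_term (int n) k)"
      by (simp only: sum_distrib_left)
    also have "\<dots> = iqfact (2*n + 1)"
      using Suc by (intro step) auto
    finally have "(\<Sum>k\<in>{-K..K}. even_term (int (Suc n)) k) * (1 - q ^ (2 * Suc n))
        = iqfact (2 * Suc n) * (1 - q ^ (2 * Suc n))"
      using iqfact_Suc[of "2*n + 1"] by (simp add: mult.commute)
    then show ?case
      using mult_right_cancel[OF one_minus_q_power_neq_0[of "2 * Suc n"]] by simp
  qed
  then show "?even n" "?odd n"
    using step K by auto
qed

section \<open>Durfee rectangles and the Bailey transform\<close>

text \<open>The expansion of \<open>1 / ((q)\<^sub>A (q)\<^bsub>A+s\<^esub>)\<close> by Durfee rectangles, a case of the
  \<open>q\<close>-Vandermonde identity.\<close>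

lemma durfee_rectangle:
  "(\<Sum>m\<le>A. q ^ (m * (m + s)) * (iqfact (A - m) * iqfact m * iqfact (m + s)))
    = iqfact A * iqfact (A + s)"
proof (induction A arbitrary: s)
  case 0
  show ?case by (simp add: iqfact_0)
next
  case (Suc A)
  define t where "t s m = q ^ (m * (m + s)) * iqfact (m + s)" for s m
  \<comment> \<open>This is 1/(q)_(m-1), set to 0 at \<open>m = 0\<close> so that the recursion
    \<open>h\<close> holds there as well.\<close>
  define h where "h m = (if m = 0 then 0 else iqfact (m - 1))" for m
  have h: "(1 - q ^ m) * iqfact m = h m" for m
    using iqfact_Suc[of "m - 1"] by (cases m) (auto simp: h_def mult.commute)
  have IH: "(\<Sum>m\<le>A. t s m * (iqfact (A - m) * iqfact m)) = iqfact A * iqfact (A + s)" for s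
    using Suc[of s] by (simp add: t_def mult_ac)
  \<comment> \<open>The splitting 1 - q^(A+1) = (1 - q^(A+1-m)) + q^(A+1-m) (1 - q^m) separates the
    sum into \<open>lower\<close> and \<open>upper\<close>.\<close>
  have pascal: "(1 - q ^ Suc A) * (iqfact (Suc A - m) * iqfact m)
      = h (Suc A - m) * iqfact m + q ^ (Suc A - m) * (iqfact (Suc A - m) * h m)" if "m \<le> Suc A" for m
  proof -
    from that have "q ^ Suc A = q ^ (Suc A - m) * q ^ m"
      by (simp flip: power_add)
    then have "(1 - q ^ Suc A) * (iqfact (Suc A - m) * iqfact m)
      = ((1 - q ^ (Suc A - m)) * iqfact (Suc A - m)) * iqfact m
        + q ^ (Suc A - m) * (iqfact (Suc A - m) * ((1 - q ^ m) * iqfact m))"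
      by (simp add: algebra_simps)
    then show ?thesis by (simp only: h)
  qed
  have lower: "(\<Sum>m\<le>Suc A. t s m * (h (Suc A - m) * iqfact m)) = iqfact A * iqfact (A + s)"
  proof -
    have "(\<Sum>m\<le>Suc A. t s m * (h (Suc A - m) * iqfact m))
        = (\<Sum>m\<le>A. t s m * (iqfact (A - m) * iqfact m))"
    proof -
      have "t s m * (h (Suc A - m) * iqfact m) = t s m * (iqfact (A - m) * iqfact m)" if "m \<le> A" for m
        using that by (simp add: h_def Suc_diff_le)
      then have "(\<Sum>m\<le>A. t s m * (h (Suc A - m) * iqfact m))
          = (\<Sum>m\<le>A. t s m * (iqfact (A - m) * iqfact m))"
        by (intro sum.cong) auto
      then show ?thesis
        unfolding sum.atMost_Suc by (simp add: h_def)
    qed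
    then show ?thesis by (simp only: IH)
  qed
  \<comment> \<open>Dropping m = 0 and shifting \<open>m\<close> turns this into the induction
    hypothesis for \<open>Suc s\<close>, hence the induction with arbitrary
    \<open>s\<close>.\<close>
  have upper: "(\<Sum>m\<le>Suc A. t s m * (q ^ (Suc A - m) * (iqfact (Suc A - m) * h m)))
      = q ^ (Suc A + s) * (iqfact A * iqfact (Suc A + s))"
  proof -
    have "t s (Suc m) * (q ^ (A - m) * (iqfact (A - m) * iqfact m))
        = q ^ (Suc A + s) * (t (Suc s) m * (iqfact (A - m) * iqfact m))" if "m \<le> A" for m
    proof -
      have "Suc m * (Suc m + s) + (A - m) = Suc A + s + m * (m + Suc s)"
        using that by (simp add: algebra_simps)
      then have "q ^ (Suc m * (Suc m + s)) * q ^ (A - m) = q ^ (Suc A + s) * q ^ (m * (m + Suc s))"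
        by (metis power_add)
      note e = this
      have "q ^ (Suc m * (Suc m + s)) * iqfact (Suc m + s) * (q ^ (A - m) * (iqfact (A - m) * iqfact m))
          = (q ^ (Suc m * (Suc m + s)) * q ^ (A - m)) * (iqfact (m + Suc s) * (iqfact (A - m) * iqfact m))"
        by (simp only: mult_ac add_Suc add_Suc_right)
      then show ?thesis
        unfolding t_def e by (simp only: mult_ac)
    qed
    then have "(\<Sum>m\<le>A. t s (Suc m) * (q ^ (A - m) * (iqfact (A - m) * iqfact m)))
        = (\<Sum>m\<le>A. q ^ (Suc A + s) * (t (Suc s) m * (iqfact (A - m) * iqfact m)))"
      by (intro sum.cong) auto
    then have "(\<Sum>m\<le>Suc A. t s m * (q ^ (Suc A - m) * (iqfact (Suc A - m) * h m)))
        = (\<Sum>m\<le>A. q ^ (Suc A + s) * (t (Suc s) m * (iqfact (A - m) * iqfact m)))"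
      unfolding sum.atMost_Suc_shift diff_Suc_Suc by (simp del: power_Suc add: h_def)
    also have "\<dots> = q ^ (Suc A + s) * (iqfact A * iqfact (Suc A + s))"
      by (simp only: sum_distrib_left[symmetric] IH add_Suc_right add_Suc)
    finally show ?thesis .
  qed
  have "(\<Sum>m\<le>Suc A. t s m * (iqfact (Suc A - m) * iqfact m)) * (1 - q ^ Suc A)
      = (\<Sum>m\<le>Suc A. t s m * ((1 - q ^ Suc A) * (iqfact (Suc A - m) * iqfact m)))"
    unfolding mult.commute[of _ "1 - q ^ Suc A"] sum_distrib_left
    by (simp only: mult.left_commute)
  also have "\<dots> = (\<Sum>m\<le>Suc A. t s m * (h (Suc A - m) * iqfact m)
      + t s m * (q ^ (Suc A - m) * (iqfact (Suc A - m) * h m)))"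
    by (intro sum.cong refl) (simp only: atMost_iff pascal distrib_left)
  also have "\<dots> = iqfact A * (iqfact (A + s) + q ^ (Suc A + s) * iqfact (Suc A + s))"
    unfolding sum.distrib lower upper by (simp add: algebra_simps)
  also have "iqfact (A + s) + q ^ (Suc A + s) * iqfact (Suc A + s) = iqfact (Suc A + s)"
    using iqfact_Suc[of "A + s", symmetric] by (simp add: algebra_simps)
  also have "iqfact A = iqfact (Suc A) * (1 - q ^ Suc A)"
    by (rule iqfact_Suc[symmetric])
  finally have "(\<Sum>m\<le>Suc A. t s m * (iqfact (Suc A - m) * iqfact m)) * (1 - q ^ Suc A)
      = (iqfact (Suc A) * iqfact (Suc A + s)) * (1 - q ^ Suc A)"
    by (simp only: mult_ac)
  then have "(\<Sum>m\<le>Suc A. t s m * (iqfact (Suc A - m) * iqfact m))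
      = iqfact (Suc A) * iqfact (Suc A + s)"
    using mult_right_cancel[OF one_minus_q_power_neq_0[of "Suc A"]] by simp
  then show ?case by (simp only: t_def mult_ac)
qed

text \<open>For r >= 0 put n = m + r. Since n^2 + n = r^2 + r + m (m + 2r + 1), this is
  \<open>durfee_rectangle\<close> with A = N - r and s = 2r + 1. The reflection r -> -1 - r
  exchanges the two \<open>iqz\<close> factors and fixes r^2 + r, which settles r < 0.\<close>

lemma bailey_sum:
  "(\<Sum>n\<le>N. q ^ (n\<^sup>2 + n) * iqfact (N - n) * (iqz (int n - r) * iqz (int n + r + 1)))
    = q ^ nat (r\<^sup>2 + r) * (iqz (int N - r) * iqz (int N + r + 1))"
proof -
  have nonneg: "(\<Sum>n\<le>N. q ^ (n\<^sup>2 + n) * iqfact (N - n) * (iqz (int n - int s) * iqz (int n + int s + 1)))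
      = q ^ (s\<^sup>2 + s) * (iqz (int N - int s) * iqz (int N + int s + 1))" for s :: nat
  proof (cases "s \<le> N")
    case True
    define A where "A = N - s"
    with True have N: "N = A + s" by simp
    have "(\<Sum>n\<le>N. q ^ (n\<^sup>2 + n) * iqfact (N - n) * (iqz (int n - int s) * iqz (int n + int s + 1)))
        = (\<Sum>n\<in>{s..N}. q ^ (n\<^sup>2 + n) * iqfact (N - n) * (iqz (int n - int s) * iqz (int n + int s + 1)))"
      by (intro sum.mono_neutral_right) (auto simp: iqz_neg)
    also have "\<dots> = (\<Sum>m\<le>A. q ^ (s\<^sup>2 + s) *
        (q ^ (m * (m + (2 * s + 1))) * (iqfact (A - m) * iqfact m * iqfact (m + (2 * s + 1)))))"
    proof (rule sum.reindex_bij_witness[of _ "\<lambda>m. m + s" "\<lambda>n. n - s"], goal_cases)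
      case (5 n)
      define m where "m = n - s"
      with 5 have n: "n = m + s" "m \<le> A" by (auto simp: N)
      have "q ^ (n\<^sup>2 + n) = q ^ (s\<^sup>2 + s) * q ^ (m * (m + (2 * s + 1)))"
        unfolding n power_add[symmetric] by (rule arg_cong[of _ _ "\<lambda>e. q ^ e"])
          (simp add: power2_eq_square algebra_simps)
      moreover have "iqz (int n - int s) = iqfact m" "iqz (int n + int s + 1) = iqfact (m + (2 * s + 1))"
        by (auto simp: n iqz_def nat_add_distrib intro!: arg_cong[of _ _ iqfact])
      moreover have "N - n = A - m" by (simp add: N n)
      ultimately show ?case
        by (simp only: m_def[symmetric] mult_ac)
    qed (auto simp: N)
    also have "\<dots> = q ^ (s\<^sup>2 + s) * (iqfact A * iqfact (A + (2 * s + 1)))"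
      by (simp only: sum_distrib_left[symmetric] durfee_rectangle)
    also have "iqfact A = iqz (int N - int s)"
      by (simp add: N)
    also have "iqfact (A + (2 * s + 1)) = iqz (int N + int s + 1)"
      by (auto simp: N iqz_def intro!: arg_cong[of _ _ iqfact])
    finally show ?thesis .
  \<comment> \<open>For s > N every term and the right-hand side contain a negative index.\<close>
  qed (auto simp: iqz_neg intro!: sum.neutral)
  show ?thesis
  proof (cases "r \<ge> 0")
    case True
    then show ?thesis using nonneg[of "nat r"]
      by (simp add: nat_add_distrib nat_power_eq)
  next
    case False
    define s where "s = nat (- 1 - r)"
    have r: "r = - 1 - int s" using False by (simp add: s_def)
    have "r\<^sup>2 + r = int (s\<^sup>2 + s)"
      by (simp add: r power2_eq_square algebra_simps)
    then have e: "nat (r\<^sup>2 + r) = s\<^sup>2 + s" by (simp only: nat_int)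
    have *: "iqz (int n - r) * iqz (int n + r + 1) = iqz (int n - int s) * iqz (int n + int s + 1)" for n
      by (simp add: r algebra_simps)
    show ?thesis unfolding e * by (rule nonneg)
  qed
qed

section \<open>The finite theta identity\<close>

definition theta_term :: "int \<Rightarrow> 'a" where
  "theta_term k = q ^ nat (15*k\<^sup>2 - 4*k) - q ^ nat (15*k\<^sup>2 + 14*k + 3)"

text \<open>The indices have the shape \<open>int N + c\<close> so that \<open>iqz_tendsto\<close>
  applies; the limit in \<open>N\<close> is \<open>iqinf * iqinf * theta_term k\<close>.\<close>

definition finite_theta_term :: "nat \<Rightarrow> int \<Rightarrow> 'a" where
  "finite_theta_term N k = q ^ nat (15*k\<^sup>2 - 4*k) * (iqz (int N + (1 - 3*k)) * iqz (int N + 3*k))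
     - q ^ nat (15*k\<^sup>2 + 14*k + 3) * (iqz (int N + (- 1 - 3*k)) * iqz (int N + (2 + 3*k)))"

lemma finite_identity:
  "(\<Sum>n\<le>N. q ^ (n\<^sup>2 + n) * iqfact (N - n) * iqfact (2*n + 1))
    = (\<Sum>k\<in>{-(int N + 1)..int N + 1}. finite_theta_term N k)"
proof -
  let ?K = "{-(int N + 1)..int N + 1}"
  let ?w = "\<lambda>n. q ^ (n\<^sup>2 + n) * iqfact (N - n)"
  have "(\<Sum>n\<le>N. ?w n * iqfact (2*n + 1)) = (\<Sum>n\<le>N. \<Sum>k\<in>?K. ?w n * odd_term (int n) k)"
  proof (intro sum.cong refl)
    fix n assume "n \<in> {..N}"
    \<comment> \<open>The bound \<open>N + 1\<close> exceeds every \<open>n\<close> in the range, so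
      one set of \<open>k\<close> serves all \<open>n\<close>.\<close>
    then have "iqfact (2*n + 1) = (\<Sum>k\<in>?K. odd_term (int n) k)"
      by (intro sum_odd_even_term(2)[symmetric]) auto
    then show "?w n * iqfact (2*n + 1) = (\<Sum>k\<in>?K. ?w n * odd_term (int n) k)"
      by (simp only: sum_distrib_left)
  qed
  also have "\<dots> = (\<Sum>k\<in>?K. \<Sum>n\<le>N. ?w n * odd_term (int n) k)"
    by (rule sum.swap)
  also have "\<dots> = (\<Sum>k\<in>?K. finite_theta_term N k)"
  proof (intro sum.cong refl)
    fix k :: int
    \<comment> \<open>Puts the indices into the form of \<open>bailey_sum\<close>, with
      \<open>r = 3*k - 1\<close> and \<open>r = 3*k + 1\<close>.\<close>
    have odd_eq: "odd_term (int n) k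
      = q ^ nat (6*k\<^sup>2 - k) * (iqz (int n - (3*k - 1)) * iqz (int n + (3*k - 1) + 1))
       - q ^ nat (6*k\<^sup>2 + 5*k + 1) * (iqz (int n - (3*k + 1)) * iqz (int n + (3*k + 1) + 1))" for n
      by (simp add: odd_term_def algebra_simps)
    have "(\<Sum>n\<le>N. ?w n * odd_term (int n) k)
       = q ^ nat (6*k\<^sup>2 - k) * (\<Sum>n\<le>N. ?w n * (iqz (int n - (3*k - 1)) * iqz (int n + (3*k - 1) + 1)))
       - q ^ nat (6*k\<^sup>2 + 5*k + 1) * (\<Sum>n\<le>N. ?w n * (iqz (int n - (3*k + 1)) * iqz (int n + (3*k + 1) + 1)))"
      unfolding odd_eq right_diff_distrib sum_subtractf sum_distrib_left by (simp only: mult_ac)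
    also have "\<dots> = q ^ nat (6*k\<^sup>2 - k) * (q ^ nat ((3*k - 1)\<^sup>2 + (3*k - 1)) *
          (iqz (int N - (3*k - 1)) * iqz (int N + (3*k - 1) + 1)))
       - q ^ nat (6*k\<^sup>2 + 5*k + 1) * (q ^ nat ((3*k + 1)\<^sup>2 + (3*k + 1)) *
          (iqz (int N - (3*k + 1)) * iqz (int N + (3*k + 1) + 1)))"
      unfolding bailey_sum by (rule refl)
    \<comment> \<open>The exponent gains (3k-1)^2 + (3k-1) = 9k^2 - 3k; in the second term the gain
      is (3k+1)^2 + (3k+1) = 9k^2 + 9k + 2.\<close>
    also have "q ^ nat (6*k\<^sup>2 - k) * (q ^ nat ((3*k - 1)\<^sup>2 + (3*k - 1)) *
          (iqz (int N - (3*k - 1)) * iqz (int N + (3*k - 1) + 1)))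
        = q ^ nat (15*k\<^sup>2 - 4*k) * (iqz (int N - (3*k - 1)) * iqz (int N + (3*k - 1) + 1))"
      using exponents_nonneg[of k]
      by (intro q_power_nat_mult) (auto simp: power2_eq_square algebra_simps)
    also have "q ^ nat (6*k\<^sup>2 + 5*k + 1) * (q ^ nat ((3*k + 1)\<^sup>2 + (3*k + 1)) *
          (iqz (int N - (3*k + 1)) * iqz (int N + (3*k + 1) + 1)))
        = q ^ nat (15*k\<^sup>2 + 14*k + 3) * (iqz (int N - (3*k + 1)) * iqz (int N + (3*k + 1) + 1))"
      using exponents_nonneg[of k]
      by (intro q_power_nat_mult) (auto simp: power2_eq_square algebra_simps)
    finally show "(\<Sum>n\<le>N. ?w n * odd_term (int n) k) = finite_theta_term N k"
      by (simp add: finite_theta_term_def algebra_simps)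
  qed
  finally show ?thesis .
qed

section \<open>The limit as N tends to infinity\<close>

lemma iqfact_bound: "\<exists>C\<ge>0. (\<forall>n. nrm (iqfact n) \<le> C) \<and> (\<forall>m. nrm (iqz m) \<le> C)"
proof -
  obtain C where C: "\<And>n. nrm (iqfact n) \<le> C"
    using iqfact_limit by blast
  have "C \<ge> 0"
    using C[of 0] zero_le_dist[of "iqfact 0" 0] by linarith
  moreover from this C have "nrm (iqz m) \<le> C" for m
    by (simp add: iqz_def)
  ultimately show ?thesis using C by blast
qed

lemma nrm_mult_mono: "nrm x \<le> a \<Longrightarrow> nrm y \<le> b \<Longrightarrow> nrm (x * y) \<le> a * b"
  by (rule order_trans[OF dist_mult_le]) (intro mult_mono, auto intro: order_trans[OF zero_le_dist])

text \<open>\<open>tannery\<close> runs backwards here: \<open>L\<close> exists by domination, and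
  for fixed \<open>n\<close> the factor 1/(q)_(N-n) tends to 1/(q)_inf. Of the power q^(n^2+n) the
  majorant keeps only |q|^n.\<close>

lemma finite_identity_tendsto:
  obtains L where "((\<lambda>n. q ^ (n\<^sup>2 + n) * iqfact (2*n + 1)) has_sum L) UNIV"
    "(\<lambda>N. \<Sum>n\<le>N. q ^ (n\<^sup>2 + n) * iqfact (N - n) * iqfact (2*n + 1)) \<longlonglongrightarrow> iqinf * L"
proof -
  obtain C where C: "C \<ge> 0" "\<And>n. nrm (iqfact n) \<le> C" "\<And>m. nrm (iqz m) \<le> C"
    using iqfact_bound by auto
  define g where "g n = q ^ (n\<^sup>2 + n) * iqfact (2*n + 1)" for n
  have g_le: "nrm (g n) \<le> C * nrm q ^ n" for n
    unfolding g_def using nrm_mult_mono[OF nrm_q_power_le[of n "n\<^sup>2 + n"] C(2)[of "2*n + 1"]]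
    by (simp add: mult.commute)
  obtain L where L: "(g has_sum L) UNIV"
    by (rule dominated_has_sum_nat[OF g_le summable_nrm_q_power])
  define f where "f N n = (if n \<le> N then iqfact (N - n) * g n else 0)" for N n
  have "(\<lambda>N. sum (f N) {..N}) \<longlonglongrightarrow> iqinf * L \<longleftrightarrow> ((\<lambda>n. iqinf * g n) has_sum (iqinf * L)) UNIV"
  proof (rule tannery)
    show "(\<lambda>n. C * C * nrm q ^ n) summable_on UNIV"
      using summable_nrm_q_power[of "C * C"] by (simp add: summable_on_UNIV_nonneg_real_iff)
    show "nrm (f N n) \<le> C * C * nrm q ^ n" for N n
      unfolding f_def using nrm_mult_mono[OF C(2)[of "N - n"] g_le[of n]] C(1) by (simp add: mult.assoc)
    show "(\<lambda>N. f N n) \<longlonglongrightarrow> iqinf * g n" for n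
    proof (rule Lim_transform_eventually)
      show "(\<lambda>N. iqz (int N + - int n) * g n) \<longlonglongrightarrow> iqinf * g n"
        by (intro tendsto_mult_nrm iqz_tendsto tendsto_const)
      show "\<forall>\<^sub>F N in sequentially. iqz (int N + - int n) * g n = f N n"
        using eventually_ge_at_top[of n]
        by eventually_elim (simp add: iqz_def f_def nat_diff_distrib)
    qed
  qed (auto simp: f_def)
  moreover have "((\<lambda>n. iqinf * g n) has_sum (iqinf * L)) UNIV"
    using L by (rule has_sum_cmult_nrm)
  moreover have "sum (f N) {..N} = (\<Sum>n\<le>N. q ^ (n\<^sup>2 + n) * iqfact (N - n) * iqfact (2*n + 1))" for N
    by (intro sum.cong) (auto simp: f_def g_def mult_ac)
  ultimately have "(\<lambda>N. \<Sum>n\<le>N. q ^ (n\<^sup>2 + n) * iqfact (N - n) * iqfact (2*n + 1)) \<longlonglongrightarrow> iqinf * L"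
    by (simp only:)
  with L[unfolded g_def] show ?thesis by (rule that)
qed

text \<open>\<open>tannery\<close> runs forwards here: the known limit yields existence and value of
  the sum over all integers. Each half of a term is at most C^2 |q|^|k|, hence the factor 2 in the
  majorant.\<close>

lemma theta_has_sum:
  assumes "(\<lambda>N. \<Sum>k\<in>{-(int N + 1)..int N + 1}. finite_theta_term N k) \<longlonglongrightarrow> L"
  shows "((\<lambda>k. iqinf * iqinf * theta_term k) has_sum L) UNIV"
proof -
  obtain C where C: "C \<ge> 0" "\<And>n. nrm (iqfact n) \<le> C" "\<And>m. nrm (iqz m) \<le> C"
    using iqfact_bound by auto
  have "(\<lambda>N. sum (finite_theta_term N) {-(int N + 1)..int N + 1}) \<longlonglongrightarrow> L
      \<longleftrightarrow> ((\<lambda>k. iqinf * iqinf * theta_term k) has_sum L) UNIV"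
  proof (rule tannery)
    show "(\<lambda>k. 2 * (C * C) * nrm q ^ nat \<bar>k\<bar>) summable_on (UNIV :: int set)"
      using dist_q by (intro summable_on_power_abs_int) auto
    show "nrm (finite_theta_term N k) \<le> 2 * (C * C) * nrm q ^ nat \<bar>k\<bar>" for N k
    proof -
      have "nrm (q ^ nat e * (iqz a * iqz b)) \<le> nrm q ^ nat \<bar>k\<bar> * (C * C)" if "e \<ge> \<bar>k\<bar>" for e a b
        using that by (intro nrm_mult_mono nrm_q_power_le C) auto
      then have "nrm (finite_theta_term N k)
          \<le> nrm q ^ nat \<bar>k\<bar> * (C * C) + nrm q ^ nat \<bar>k\<bar> * (C * C)"
        unfolding finite_theta_term_def
        using exponents_nonneg(5,6)[of k] by (intro order_trans[OF nrm_diff_le] add_mono)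
      then show ?thesis by simp
    qed
    show "(\<lambda>N. finite_theta_term N k) \<longlonglongrightarrow> iqinf * iqinf * theta_term k" for k
    proof -
      have "(\<lambda>N. finite_theta_term N k) \<longlonglongrightarrow> q ^ nat (15*k\<^sup>2 - 4*k) * (iqinf * iqinf)
          - q ^ nat (15*k\<^sup>2 + 14*k + 3) * (iqinf * iqinf)"
        unfolding finite_theta_term_def
        by (intro tendsto_diff_nrm tendsto_mult_nrm iqz_tendsto tendsto_const)
      then show ?thesis
        by (simp add: theta_term_def algebra_simps)
    qed
    show "finite_theta_term N k = 0" if "k \<notin> {-(int N + 1)..int N + 1}" for N k
    proof -
      from that have "k < -(int N + 1) \<or> k > int N + 1" by auto
      then show ?thesis by (auto simp: finite_theta_term_def iqz_neg)
    qed
  qed auto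
  with assms show ?thesis by blast
qed

lemma rogers_identity:
  "(\<lambda>k. q powi (15*k\<^sup>2 - 4*k) - q powi (15*k\<^sup>2 + 14*k + 3)) summable_on UNIV"
  "(\<lambda>n. q ^ (n\<^sup>2 + n) / qfact q (2*n + 1)) sums
     (1 / qfact_inf q * (\<Sum>\<^sub>\<infinity>k. q powi (15*k\<^sup>2 - 4*k) - q powi (15*k\<^sup>2 + 14*k + 3)))"
proof -
  obtain L where L: "((\<lambda>n. q ^ (n\<^sup>2 + n) * iqfact (2*n + 1)) has_sum L) UNIV"
    "(\<lambda>N. \<Sum>n\<le>N. q ^ (n\<^sup>2 + n) * iqfact (N - n) * iqfact (2*n + 1)) \<longlonglongrightarrow> iqinf * L"
    using finite_identity_tendsto by blast
  have unit: "iqinf * qfact_inf q = 1"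
    using iqfact_limit by blast
  have "((\<lambda>k. iqinf * iqinf * theta_term k) has_sum (iqinf * L)) UNIV"
    using L(2) unfolding finite_identity by (rule theta_has_sum)
  \<comment> \<open>Multiplying by (q)_inf^2 removes both reciprocals by \<open>unit\<close> and
    leaves (q)_inf L as the value of the theta series.\<close>
  from has_sum_cmult_nrm[OF this, of "qfact_inf q * qfact_inf q"]
  have "((\<lambda>k. (iqinf * qfact_inf q) * (iqinf * qfact_inf q) * theta_term k)
      has_sum ((iqinf * qfact_inf q) * qfact_inf q * L)) UNIV"
    by (simp only: mult_ac)
  then have theta: "(theta_term has_sum (qfact_inf q * L)) UNIV"
    by (simp add: unit)
  have theta_term: "theta_term = (\<lambda>k. q powi (15*k\<^sup>2 - 4*k) - q powi (15*k\<^sup>2 + 14*k + 3))"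
  proof
    fix k :: int
    have "15*k\<^sup>2 - 4*k \<ge> 0" "15*k\<^sup>2 + 14*k + 3 \<ge> 0"
      using exponents_nonneg(5,6)[of k] by linarith+
    then show "theta_term k = q powi (15*k\<^sup>2 - 4*k) - q powi (15*k\<^sup>2 + 14*k + 3)"
      by (simp add: theta_term_def power_int_def)
  qed
  show "(\<lambda>k. q powi (15*k\<^sup>2 - 4*k) - q powi (15*k\<^sup>2 + 14*k + 3)) summable_on UNIV"
    using theta unfolding theta_term by (rule has_sum_imp_summable)
  have "(\<Sum>\<^sub>\<infinity>k. q powi (15*k\<^sup>2 - 4*k) - q powi (15*k\<^sup>2 + 14*k + 3)) = qfact_inf q * L"
    using theta unfolding theta_term by (rule infsumI)
  moreover have "iqinf * (qfact_inf q * L) = L"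
    using unit by (simp flip: mult.assoc)
  moreover have "(\<lambda>n. q ^ (n\<^sup>2 + n) * iqfact (2*n + 1)) sums L"
    using L(1) by (rule has_sum_imp_sums)
  ultimately show "(\<lambda>n. q ^ (n\<^sup>2 + n) / qfact q (2*n + 1)) sums
     (1 / qfact_inf q * (\<Sum>\<^sub>\<infinity>k. q powi (15*k\<^sup>2 - 4*k) - q powi (15*k\<^sup>2 + 14*k + 3)))"
    by (simp only: div_qfact iqinf_def[symmetric])
qed

end

section \<open>The formal and the complex instance\<close>

text \<open>A nonzero series f has distance 2^(-subdegree f) from 0. Subdegrees add in products, and
  \<open>fps_X\<close> has distance 1/2.\<close>

lemma submultiplicative_dist_fps:
  "submultiplicative_dist (fps_X :: 'a :: field fps)"
proof
  fix x y z :: "'a fps"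
  show "dist (x + z) (y + z) = dist x y"
    by (simp add: dist_fps_def)
  show "dist (x * y) 0 \<le> dist x 0 * dist y 0"
    by (simp add: dist_fps_def power_add)
qed (simp_all add: dist_fps_def)

lemma submultiplicative_dist_complex:
  "norm q < 1 \<Longrightarrow> submultiplicative_dist (q :: complex)"
  by unfold_locales (simp_all add: norm_mult)

theorem corollary5p2:
  shows
    "((\<lambda>k::int. (fps_X :: 'a::field fps) powi (15*k\<^sup>2 - 4*k) - fps_X powi (15*k\<^sup>2 + 14*k + 3))
        summable_on UNIV \<and>
      (\<lambda>n::nat. (fps_X :: 'a fps) ^ (n\<^sup>2 + n) / qfact fps_X (2*n + 1)) sums
        (1 / qfact_inf fps_X *
          (\<Sum>\<^sub>\<infinity>k::int. fps_X powi (15*k\<^sup>2 - 4*k) - fps_X powi (15*k\<^sup>2 + 14*k + 3)))) \<and>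
     (\<forall>q::complex. norm q < 1 \<longrightarrow>
      (\<lambda>k::int. q powi (15*k\<^sup>2 - 4*k) - q powi (15*k\<^sup>2 + 14*k + 3)) summable_on UNIV \<and>
      (\<lambda>n::nat. q ^ (n\<^sup>2 + n) / qfact q (2*n + 1)) sums
        (1 / qfact_inf q *
          (\<Sum>\<^sub>\<infinity>k::int. q powi (15*k\<^sup>2 - 4*k) - q powi (15*k\<^sup>2 + 14*k + 3))))"
  using submultiplicative_dist.rogers_identity[OF submultiplicative_dist_fps]
    submultiplicative_dist.rogers_identity[OF submultiplicative_dist_complex]
  by blast

end
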